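(* Let $\mathbb{A} = \{a_1, a_2, \ldots, a_k\}_{\vec r}$ be a sequence of positive integers with $a_1 < a_2 < \cdots < a_k$, $\vec r = (r_1, \ldots, r_k)$ and $r_i \geq 1$ for all $i \in [1,k]$. Let $A = \{a_1, \ldots, a_k\}$ and suppose $d(A) = 1$. Then \[ |S(\mathbb{A})| \geq \begin{cases} \sum_{i=1}^k i r_i + a_k - k & \text{if } a_k \leq 2k-3,\\ \sum_{i=1}^k i r_i + \theta(k+1) - k - 4 & \text{if } a_k \geq 2k-2. \end{cases} \]
   Context: The notation $\mathbb{A} = \{a_1, \ldots, a_k\}_{\vec r}$ with $\vec r = (r_1,\ldots,r_k)$ means $\mathbb{A}$ is a finite sequence consisting of the $k$ distinct integers $a_1,\ldots,a_k$, where $a_i$ appears exactly $r_i$ times. $S(\mathbb{A}) = \{\sum_{b \in \mathbb{B}} b : \mathbb{B} \text{ a nonempty subsequence of } \mathbb{A}\}$ is the set of nonempty subsequence sums. $d(A)$ is the greatest common divisor of the elements of $A$; $[x,y]=\{x,x+1,\ldots,y\}$. $\theta = \frac{1+\sqrt5}{2}$. *)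

theory Defs
  imports Complex_Main "HOL-Library.Sublist"
begin

definition golden :: real where
  "golden = (1 + sqrt 5) / 2"

text \<open>The family \<open>a\<close> and the multiplicities \<open>r\<close> are only relevant on the index range \<open>{1..k}\<close>.
  The order of the terms of the sequence is arbitrary.\<close>

definition seq_of :: "nat \<Rightarrow> (nat \<Rightarrow> int) \<Rightarrow> (nat \<Rightarrow> nat) \<Rightarrow> int list \<Rightarrow> bool" where
  "seq_of k a r xs \<longleftrightarrow>
     inj_on a {1..k} \<and> set xs = a ` {1..k} \<and> (\<forall>i\<in>{1..k}. count_list xs (a i) = r i)"

definition subseq_sums :: "int list \<Rightarrow> int set" where
  "subseq_sums xs = {sum_list ys | ys. subseq ys xs \<and> ys \<noteq> []}"

end

theory Submission
  imports Defs "HOL-Library.Multiset"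
begin

text \<open>
  Let \<open>l = a\<^sub>k\<close> and \<open>B = {a\<^sub>1, \<dots>, a\<^sub>k\<^sub>-\<^sub>1}\<close>, and count the empty sum as well. Adjoining \<open>l\<close> to \<open>B\<close>
  creates at least one new subset sum for every residue class modulo \<open>l\<close> met by the sums of \<open>B\<close>, and
  each further copy of \<open>a\<^sub>i\<close> creates at least \<open>i\<close> new sums near the top. So only the number
  of residues of the sums of \<open>B\<close> modulo \<open>l\<close> matters. If \<open>l \<le> 2k - 3\<close>, the pigeonhole principle applied to
  \<open>B \<union> {0}\<close> shows that every residue occurs. If \<open>l \<ge> 2k - 2\<close>, there are at least \<open>2k - 3\<close> residues, by
  induction on \<open>B\<close>: an element whose removal destroys generation of \<open>\<int>/l\<close> doubles the set of residues;
  otherwise some element contributes two new residues, or the set of residues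
  is stable up to one element under every translation by \<open>B\<close>, and then it misses at most one class.
  This is stronger than the bound with the golden ratio, since \<open>\<theta>(k + 1) \<le> 2k + 1\<close> for \<open>k \<ge> 2\<close>.
\<close>

section \<open>Subset sums of finite multisets of integers\<close>

text \<open>The empty sum is kept, unlike in \<open>subseq_sums\<close>: this makes the recursion
  \<open>msums_add\<close> free of exceptions and the set symmetric under \<open>s\<close> to
  \<open>sum_mset M - s\<close>.\<close>

definition msums :: "int multiset \<Rightarrow> int set" where
  "msums M = sum_mset ` {N. N \<subseteq># M}"

lemma msums_empty [simp]: "msums {#} = {0}"
  by (simp add: msums_def)

lemma msums_add: "msums (add_mset x M) = msums M \<union> (\<lambda>s. s + x) ` msums M"
proof (intro equalityI subsetI)
  fix s assume "s \<in> msums (add_mset x M)"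
  then obtain N where N: "N \<subseteq># add_mset x M" "s = sum_mset N" by (auto simp: msums_def)
  show "s \<in> msums M \<union> (\<lambda>s. s + x) ` msums M"
  proof (cases "x \<in># N")
    case True
    then obtain N' where "N = add_mset x N'" by (metis insert_DiffM)
    with N show ?thesis by (auto simp: msums_def)
  next
    case False
    with N(1) have "N \<subseteq># M"
      by (metis diff_single_trivial subset_eq_diff_conv add_mset_add_single)
    with N(2) show ?thesis by (auto simp: msums_def)
  qed
next
  fix s assume "s \<in> msums M \<union> (\<lambda>s. s + x) ` msums M"
  then consider "s \<in> msums M" | t where "t \<in> msums M" "s = t + x" by blast
  then show "s \<in> msums (add_mset x M)"
  proof cases
    case 1
    have "M \<subseteq># add_mset x M" by simp
    with 1 show ?thesis unfolding msums_def by (blast intro: subset_mset.order_trans)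
  next
    case 2
    then obtain N where "N \<subseteq># M" "t = sum_mset N" by (auto simp: msums_def)
    with 2 have "add_mset x N \<subseteq># add_mset x M" "s = sum_mset (add_mset x N)" by auto
    then show ?thesis unfolding msums_def by blast
  qed
qed

lemma finite_msums [simp]: "finite (msums M)"
  by (induction M) (simp_all add: msums_add)

lemma zero_in_msums [simp]: "0 \<in> msums M"
  by (auto simp: msums_def intro!: image_eqI[of _ _ "{#}"])

lemma elem_in_msums: "x \<in># M \<Longrightarrow> x \<in> msums M"
  by (auto simp: msums_def intro!: image_eqI[of _ _ "{#x#}"])

text \<open>Pass to the complementary submultiset. This reflection later supplies sums close to the
  total and the symmetry of the residue set.\<close>

lemma msums_complement:
  assumes "s \<in> msums M" shows "sum_mset M - s \<in> msums M"
proof -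
  obtain N where N: "N \<subseteq># M" "s = sum_mset N" using assms by (auto simp: msums_def)
  then have "sum_mset (M - N) = sum_mset M - s"
    by (metis add_diff_cancel_left' subset_mset.add_diff_inverse sum_mset.union)
  then show ?thesis unfolding msums_def by (metis (mono_tags) diff_subset_eq_self image_eqI mem_Collect_eq)
qed

lemma msums_nonneg:
  assumes "\<And>x. x \<in># M \<Longrightarrow> 0 < x" "s \<in> msums M" shows "0 \<le> s"
  using assms by (induction M arbitrary: s) (force simp: msums_add)+

lemma dvd_msums:
  assumes "\<And>x. x \<in># M \<Longrightarrow> d dvd x" "s \<in> msums M" shows "d dvd s"
  using assms by (induction M arbitrary: s) (auto simp: msums_add)

lemma subseq_sum_image: "{sum_list ys | ys. subseq ys xs} = msums (mset xs)"
proof (induction xs)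
  case Nil
  have "{sum_list ys | ys. subseq ys ([] :: int list)} = {sum_list []}"
    by (auto simp del: sum_list.Nil dest: list_emb_Nil2)
  then show ?case by simp
next
  case (Cons x xs)
  have "{sum_list ys | ys. subseq ys (x # xs)} =
      {sum_list ys | ys. subseq ys xs} \<union> (\<lambda>s. s + x) ` {sum_list ys | ys. subseq ys xs}"
  proof (intro equalityI subsetI)
    fix s assume "s \<in> {sum_list ys | ys. subseq ys (x # xs)}"
    then obtain ys where ys: "subseq ys (x # xs)" "s = sum_list ys" by blast
    then consider "subseq ys xs" | zs where "ys = x # zs" "subseq zs xs"
      by (cases ys) (auto split: if_splits)
    then show "s \<in> {sum_list ys | ys. subseq ys xs} \<union> (\<lambda>s. s + x) ` {sum_list ys | ys. subseq ys xs}"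
      by cases (use ys in \<open>auto simp: add.commute\<close>)
  next
    fix s assume "s \<in> {sum_list ys | ys. subseq ys xs} \<union> (\<lambda>s. s + x) ` {sum_list ys | ys. subseq ys xs}"
    then consider ys where "subseq ys xs" "s = sum_list ys"
      | ys where "subseq ys xs" "s = sum_list (x # ys)" by (auto simp: add.commute)
    then show "s \<in> {sum_list ys | ys. subseq ys (x # xs)}"
    proof cases
      case 1
      then show ?thesis by auto
    next
      case 2
      then have "subseq (x # ys) (x # xs)" by simp
      with 2 show ?thesis by blast
    qed
  qed
  then show ?case by (simp add: Cons msums_add)
qed

lemma sum_list_pos_int:
  fixes ys :: "int list"
  assumes "\<And>y. y \<in> set ys \<Longrightarrow> 0 < y" "ys \<noteq> []" shows "0 < sum_list ys"
proof (cases ys)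
  case (Cons z zs)
  have "0 \<le> sum_list zs" using assms Cons by (intro sum_list_nonneg) (auto intro: less_imp_le)
  then show ?thesis using assms(1)[of z] Cons by simp
qed (use assms in simp)

text \<open>The extra element is 0, which positivity reserves for the empty subsequence.\<close>

lemma card_subseq_sums:
  assumes pos: "\<And>x. x \<in> set xs \<Longrightarrow> 0 < x"
  shows "Suc (card (subseq_sums xs)) = card (msums (mset xs))"
proof -
  have "subseq_sums xs = msums (mset xs) - {0}"
  proof -
    have "sum_list ys \<noteq> 0" if "subseq ys xs" "ys \<noteq> []" for ys
      using sum_list_pos_int[of ys] that(2) pos set_nths_subset[of xs] that(1)[unfolded subseq_conv_nths]
      by (metis less_irrefl subsetD)
    then show ?thesis
      unfolding subseq_sum_image[symmetric] subseq_sums_def by (auto intro: exI[of _ "[]"])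
  qed
  then show ?thesis using card_Suc_Diff1[of "msums (mset xs)" 0] by simp
qed

section \<open>Growth of the set of sums when a term is adjoined\<close>

text \<open>Dropping at most one \<open>y\<close> in \<open>D\<close> from the full sum and adding
  \<open>x\<close> gives a value above \<open>sum_mset M\<close>, since \<open>y < x\<close>. These
  \<open>card D + 1\<close> values are distinct and cannot be sums of \<open>M\<close>.\<close>

lemma card_msums_add:
  assumes pos: "\<And>y. y \<in># M \<Longrightarrow> 0 < y" and "0 < x"
    and D: "D \<subseteq> set_mset M" "\<And>y. y \<in> D \<Longrightarrow> y < x"
  shows "card (msums M) + card D + 1 \<le> card (msums (add_mset x M))"
proof -
  have finD: "finite D" using D(1) finite_subset by blast
  have 0: "0 \<notin> D" using D(1) pos by force
  have le: "s \<le> sum_mset M" if "s \<in> msums M" for s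
    using msums_nonneg[OF pos msums_complement[OF that]] by simp
  let ?g = "\<lambda>y. sum_mset M - y + x"
  have sub: "?g ` insert 0 D \<subseteq> msums (add_mset x M)"
  proof -
    have "sum_mset M - y \<in> msums M" if "y \<in> insert 0 D" for y
      using that D(1) by (intro msums_complement) (auto intro: elem_in_msums)
    then show ?thesis unfolding msums_add by blast
  qed
  have "msums M \<inter> ?g ` insert 0 D = {}"
    using le D(2) \<open>0 < x\<close> by force
  moreover have "card (?g ` insert 0 D) = card D + 1"
    using finD 0 by (subst card_image) (auto simp: inj_on_def)
  moreover have "msums M \<union> ?g ` insert 0 D \<subseteq> msums (add_mset x M)"
    using sub by (auto simp: msums_add)
  ultimately show ?thesis
    using card_Un_disjoint[of "msums M" "?g ` insert 0 D"] finD card_mono[of "msums (add_mset x M)"]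
    by (metis add.assoc finite.insertI finite_imageI finite_msums)
qed

text \<open>Adjoin the elements in increasing order: the \<open>j - 1\<close> elements before the
  \<open>j\<close>-th serve as \<open>D\<close> in \<open>card_msums_add\<close>, which yields
  \<open>j\<close> new sums.\<close>

lemma card_msums_set:
  assumes "finite A" "\<And>x. x \<in> A \<Longrightarrow> 0 < x"
  shows "1 + (\<Sum>i=1..card A. i) \<le> card (msums (mset_set A))"
  using assms
proof (induction A rule: finite_linorder_max_induct)
  case empty
  then show ?case by simp
next
  case (insert b A)
  have "b \<notin> A" using insert by blast
  have "card (msums (mset_set A)) + card A + 1 \<le> card (msums (add_mset b (mset_set A)))"
    using insert by (intro card_msums_add) auto
  with insert \<open>b \<notin> A\<close> show ?case by simp
qed

text \<open>One copy of all of \<open>A\<close> is already present, so a further copy of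
  \<open>x\<close> may use every smaller element of \<open>A\<close> as \<open>D\<close>; it gains
  its rank in \<open>A\<close>.\<close>

lemma card_msums_extra:
  assumes "finite A" "\<And>x. x \<in> A \<Longrightarrow> 0 < x" "set_mset E \<subseteq> A"
  shows "card (msums (mset_set A)) + (\<Sum>x\<in>#E. card {y \<in> A. y \<le> x}) \<le> card (msums (mset_set A + E))"
  using assms(3)
proof (induction E)
  case empty
  then show ?case by simp
next
  case (add x E)
  have "card (msums (mset_set A + E)) + card {y \<in> A. y < x} + 1
      \<le> card (msums (add_mset x (mset_set A + E)))"
    using add assms(1,2) by (intro card_msums_add) auto
  moreover have "{y \<in> A. y \<le> x} = insert x {y \<in> A. y < x}" using add by auto
  then have "card {y \<in> A. y \<le> x} = card {y \<in> A. y < x} + 1" using assms(1) by simp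
  ultimately show ?case using add by simp
qed

section \<open>Residues of subset sums modulo \<open>l\<close>\<close>

definition residue_sums :: "int \<Rightarrow> int set \<Rightarrow> int set" where
  "residue_sums l B = (\<lambda>s. s mod l) ` msums (mset_set B)"

lemma finite_residue_sums [simp]: "finite (residue_sums l B)"
  by (simp add: residue_sums_def)

lemma residue_sums_subset: "0 < l \<Longrightarrow> residue_sums l B \<subseteq> {0..<l}"
  by (auto simp: residue_sums_def)

text \<open>In every class modulo \<open>l\<close> met by \<open>msums M\<close>, the largest element shifted by \<open>l\<close> is new.\<close>

lemma card_msums_add_residues:
  assumes "0 < l"
  shows "card (msums M) + card ((\<lambda>s. s mod l) ` msums M) \<le> card (msums (add_mset l M))"
proof -
  let ?R = "(\<lambda>s. s mod l) ` msums M"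
  define g where "g r = Max {s \<in> msums M. s mod l = r}" for r
  have g: "g r \<in> msums M" "g r mod l = r" "g r + l \<notin> msums M" if "r \<in> ?R" for r
  proof -
    let ?F = "{s \<in> msums M. s mod l = r}"
    have fin: "finite ?F" "?F \<noteq> {}" using that by auto
    have "g r \<in> ?F" unfolding g_def using Max_in[OF fin] .
    then show 1: "g r \<in> msums M" "g r mod l = r" by auto
    show "g r + l \<notin> msums M"
    proof
      assume "g r + l \<in> msums M"
      then have "g r + l \<in> ?F" using 1 by simp
      then have "g r + l \<le> g r" unfolding g_def using Max_ge[OF fin(1)] by blast
      with assms show False by simp
    qed
  qed
  let ?N = "(\<lambda>r. g r + l) ` ?R"
  have "inj_on (\<lambda>r. g r + l) ?R" using g(2) by (intro inj_onI) (metis add_right_cancel)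
  then have "card ?N = card ?R" by (rule card_image)
  moreover have "msums M \<inter> ?N = {}" using g(3) by auto
  moreover have "msums M \<union> ?N \<subseteq> msums (add_mset l M)" using g(1) by (auto simp: msums_add)
  ultimately show ?thesis
    using card_Un_disjoint[of "msums M" ?N] card_mono[of "msums (add_mset l M)" "msums M \<union> ?N"] by simp
qed

lemma residue_sums_insert:
  assumes "finite B" "b \<notin> B"
  shows "residue_sums l (insert b B) = residue_sums l B \<union> (\<lambda>r. (r + b) mod l) ` residue_sums l B"
  using assms by (simp add: residue_sums_def msums_add image_Un image_image mod_add_left_eq)

lemma mod_in_residue_sums_complement:
  assumes "x mod l \<in> residue_sums l B"
  shows "(sum_mset (mset_set B) - x) mod l \<in> residue_sums l B"
proof -
  obtain s where s: "s \<in> msums (mset_set B)" "x mod l = s mod l"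
    using assms by (auto simp: residue_sums_def)
  have "(sum_mset (mset_set B) - x) mod l = (sum_mset (mset_set B) - s) mod l"
    using s(2) by (metis mod_diff_right_eq)
  then show ?thesis using msums_complement[OF s(1)] by (auto simp: residue_sums_def)
qed

section \<open>Translation-invariant sets of integers\<close>

lemma Gcd_in_subgroup:
  fixes F :: "int set"
  assumes "finite F" "F \<subseteq> H" "0 \<in> H" "\<And>x y. x \<in> H \<Longrightarrow> y \<in> H \<Longrightarrow> x + y \<in> H"
    "\<And>n x. x \<in> H \<Longrightarrow> n * x \<in> H"
  shows "Gcd F \<in> H"
  using assms(1,2)
proof (induction F)
  case empty
  then show ?case using assms(3) by simp
next
  case (insert c F)
  obtain u v where "u * c + v * Gcd F = gcd c (Gcd F)" using bezout_int by blast
  then show ?case using insert assms(4,5) by (metis Gcd_insert insert_subset)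
qed

text \<open>The translations mapping \<open>X\<close> into itself form a monoid \<open>H\<close>.
  Periodicity makes it a group, since the factor \<open>n\<close> may be replaced by the nonnegative
  \<open>n mod l\<close>. It contains \<open>l\<close> and \<open>B\<close>, hence their gcd
  1.\<close>

lemma translation_closed_UNIV:
  fixes X :: "int set"
  assumes "0 < l" "finite B" "Gcd (insert l B) = 1"
    and per: "\<And>x y. l dvd x - y \<Longrightarrow> x \<in> X \<Longrightarrow> y \<in> X"
    and closed: "\<And>b x. b \<in> B \<Longrightarrow> x \<in> X \<Longrightarrow> x + b \<in> X"
    and "x0 \<in> X"
  shows "x \<in> X"
proof -
  define H where "H = {d. \<forall>x\<in>X. x + d \<in> X}"
  have nat_mult: "int n * d \<in> H" if "d \<in> H" for n d
    proof (induction n)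
    case (Suc n)
    have "x + d + int n * d \<in> X" if "x \<in> X" for x using that Suc \<open>d \<in> H\<close> by (auto simp: H_def)
    then show ?case by (simp add: H_def algebra_simps)
  qed (simp add: H_def)
  have mult: "n * d \<in> H" if d: "d \<in> H" for n d
  proof -
    have "int (nat (n mod l)) * d \<in> H" using nat_mult[OF d] .
    then have *: "(n mod l) * d \<in> H" using \<open>0 < l\<close> by simp
    have "n * d = (n mod l) * d + l * ((n div l) * d)"
      by (metis distrib_right mod_mult_div_eq mult.assoc)
    then have "l dvd (y + (n mod l) * d) - (y + n * d)" for y by simp
    with * per show ?thesis unfolding H_def by blast
  qed
  have "Gcd (insert l B) \<in> H"
  proof (rule Gcd_in_subgroup)
    show "insert l B \<subseteq> H"
    proof -
      have "l \<in> H" unfolding H_def by (auto intro!: per[of x "x + l" for x])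
      then show ?thesis using closed by (auto simp: H_def)
    qed
    show "x + y \<in> H" if "x \<in> H" "y \<in> H" for x y
      using that unfolding H_def by (simp add: add.assoc[symmetric])
  qed (use assms(2) mult in \<open>auto simp: H_def\<close>)
  then have "1 \<in> H" using assms(3) by simp
  then have "(x - x0) * 1 \<in> H" using mult by blast
  then show ?thesis using \<open>x0 \<in> X\<close> unfolding H_def by force
qed

text \<open>Call \<open>x \<in> T\<close> an exit for \<open>b\<close> if \<open>x + b \<notin> T\<close>. If \<open>e\<close> is an exit for \<open>b\<close>, uniqueness of exits
  forces the class of \<open>e\<close> to be isolated in \<open>T\<close>, or that of \<open>e + b\<close> to be isolated in the complement,
  with respect to translation by \<open>b\<close> and every other \<open>c\<close>; removing this class from \<open>T\<close>, or from the
  complement, leaves a set invariant under all translations.\<close>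

lemma unique_exit_imp_at_most_one_class_missing:
  fixes T B :: "int set"
  assumes "0 < l" "finite B" "Gcd (insert l B) = 1" "3 \<le> card B"
    and per: "\<And>x y. l dvd x - y \<Longrightarrow> x \<in> T \<Longrightarrow> y \<in> T"
    and symm: "\<And>x. x \<in> T \<Longrightarrow> \<sigma> - x \<in> T"
    and exit: "\<And>b x y. b \<in> B \<Longrightarrow> x \<in> T \<Longrightarrow> x + b \<notin> T \<Longrightarrow> y \<in> T \<Longrightarrow> y + b \<notin> T \<Longrightarrow> l dvd x - y"
    and nz: "\<And>b. b \<in> B \<Longrightarrow> \<not> l dvd b"
    and dist: "\<And>b c. b \<in> B \<Longrightarrow> c \<in> B \<Longrightarrow> b \<noteq> c \<Longrightarrow> \<not> l dvd b - c"
    and t: "t1 \<in> T" "t2 \<in> T" "\<not> l dvd t1 - t2"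
  shows "\<exists>f. \<forall>x. x \<notin> T \<longrightarrow> l dvd x - f"
proof (cases "\<exists>b\<in>B. \<exists>e\<in>T. e + b \<notin> T")
  case False
  then have "x \<in> T" for x
    using translation_closed_UNIV[of l B T t1 x] assms(1-3) per t(1) by blast
  then show ?thesis by blast
next
  case True
  \<comment> \<open>Reflection in \<sigma> turns a step from outside into \<open>T\<close> into an
    exit, so entries are unique modulo \<open>l\<close> as well.\<close>
  have entry: "l dvd x - y" if "b \<in> B" "x \<notin> T" "x + b \<in> T" "y \<notin> T" "y + b \<in> T" for b x y
  proof -
    have *: "\<sigma> - (z + b) \<in> T \<and> \<sigma> - (z + b) + b \<notin> T" if "z \<notin> T" "z + b \<in> T" for z
      using symm[of "z + b"] symm[of "\<sigma> - z"] that by auto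
    have "l dvd (\<sigma> - (y + b)) - (\<sigma> - (x + b))"
      using *[OF that(2,3)] *[OF that(4,5)] exit[OF that(1)] by blast
    then show ?thesis by simp
  qed
  \<comment> \<open>First alternative: no neighbour of \<open>e\<close> by \<open>b\<close> or
    \<open>c\<close> lies in \<open>T\<close>. Second: all neighbours of the gap
    \<open>e + b\<close> do. A mixed pattern would create a second exit or entry for
    \<open>b\<close> or \<open>c\<close>.\<close>
  have dich: "e + c \<notin> T \<and> e - b \<notin> T \<and> e - c \<notin> T \<or>
      e + c \<in> T \<and> e + b + c \<in> T \<and> e + 2 * b \<in> T \<and> e + b - c \<in> T"
    if b: "b \<in> B" and c: "c \<in> B" and ne: "b \<noteq> c" "\<not> l dvd b + c" and e: "e \<in> T" "e + b \<notin> T" for b c e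
  proof (cases "e + c \<in> T")
    case False
    have "e - b \<notin> T"
    proof
      assume *: "e - b \<in> T"
      have "e - b + c \<in> T"
        using exit[OF c * _ e(1) False] nz[OF b] by auto
      then have "l dvd (e - b + c) - e"
        using exit[OF b, of "e - b + c" e] False e by (simp add: algebra_simps)
      then show False using dist[OF c b] ne by (simp add: algebra_simps)
    qed
    moreover have "e - c \<notin> T"
    proof
      assume *: "e - c \<in> T"
      have "e - c + b \<in> T"
        using exit[OF b * _ e] nz[OF c] by auto
      then have "l dvd (e - c + b) - e"
        using exit[OF c, of "e - c + b" e] False e by (simp add: algebra_simps)
      then show False using dist[OF b c] ne by (simp add: algebra_simps)
    qed
    ultimately show ?thesis using False by blast
  next
    case True
    have ebc: "e + b + c \<in> T"
      using exit[OF b True _ e] nz[OF c] by (auto simp: algebra_simps)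
    have "e + 2 * b \<in> T"
    proof (rule ccontr)
      assume *: "e + 2 * b \<notin> T"
      have "e + 2 * b + c \<in> T"
        using exit[OF b ebc _ e] ne(2) by (auto simp: algebra_simps)
      then have "l dvd (e + 2 * b) - (e + b)"
        using entry[OF c * _ e(2) ebc] by simp
      then show False using nz[OF b] by simp
    qed
    moreover have "e + b - c \<in> T"
    proof (rule ccontr)
      assume *: "e + b - c \<notin> T"
      have "e - c \<notin> T"
        using exit[OF b _ _ e, of "e - c"] * nz[OF c] by (auto simp: algebra_simps)
      then have "l dvd (e + b) - (e - c)"
        using entry[OF c e(2) ebc, of "e - c"] e by simp
      then show False using ne(2) by (simp add: algebra_simps)
    qed
    ultimately show ?thesis using True ebc by blast
  qed
  \<comment> \<open>The later argument must tell \<open>e - b\<close> from \<open>e + b\<close>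
    modulo \<open>l\<close>. If \<open>b\<close> has order two, no other \<open>c\<close> in
    \<open>B\<close> does, and \<open>dich\<close> gives an exit for such a \<open>c\<close>: either
    \<open>e\<close> itself or the reflection of the entry at \<open>e + b\<close>.\<close>
  obtain b e where b: "b \<in> B" and e: "e \<in> T" "e + b \<notin> T" and b2: "\<not> l dvd 2 * b"
  proof -
    obtain b e where b: "b \<in> B" and e: "e \<in> T" "e + b \<notin> T" using True by blast
    show thesis
    proof (cases "l dvd 2 * b")
      case False
      then show ?thesis using that b e by blast
    next
      case True
      obtain c where c: "c \<in> B" "b \<noteq> c"
        using assms(2,4) b
        by (metis card_le_Suc0_iff_eq not_numeral_le_zero numeral_3_eq_3 Suc_le_mono le_trans le0)
      \<comment> \<open>If \<open>b\<close> and \<open>c\<close> both had order two, the cofactors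
        \<open>p\<close> and \<open>q\<close> would be odd, and their even difference would make
        \<open>l\<close> divide \<open>b - c\<close>.\<close>
      have odd: "odd p" if "2 * u = l * p" "\<not> l dvd u" for u p
        using that by (auto elim!: evenE)
      have c2: "\<not> l dvd 2 * c"
      proof
        assume "l dvd 2 * c"
        then obtain p q where pq: "2 * b = l * p" "2 * c = l * q" using True by (meson dvdE)
        then have "odd p" "odd q" using odd nz b c by blast+
        then obtain r where "p - q = 2 * r" by (metis odd_even_add even_diff evenE)
        moreover have "2 * (b - c) = l * (p - q)" using pq by (simp add: algebra_simps)
        ultimately have "b - c = l * r" by simp
        then show False using dist[OF b c(1,2)] by simp
      qed
      have "\<not> l dvd b + c"
      proof
        assume "l dvd b + c"
        then have "l dvd 2 * b - (b + c)" using True by (rule dvd_diff[rotated])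
        then show False using dist[OF b c] by simp
      qed
      from dich[OF b c(1,2) this e] show ?thesis
      proof
        assume "e + c \<notin> T \<and> e - b \<notin> T \<and> e - c \<notin> T"
        then show ?thesis using that[OF c(1) e(1) _ c2] by blast
      next
        assume "e + c \<in> T \<and> e + b + c \<in> T \<and> e + 2 * b \<in> T \<and> e + b - c \<in> T"
        then have "\<sigma> - (e + b + c) \<in> T" "\<sigma> - (e + b + c) + c \<notin> T"
          using symm[of "e + b + c"] symm[of "\<sigma> - (e + b)"] e by (auto simp: diff_diff_eq[symmetric])
        then show ?thesis using that[OF c(1) _ _ c2] by blast
      qed
    qed
  qed
  \<comment> \<open>Only \<open>b\<close> and the elements congruent to \<open>- b\<close> are left
    out. There is at most one of the latter, so three elements of \<open>B\<close> leave some
    \<open>c0\<close>.\<close>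
  let ?C = "{c \<in> B. c \<noteq> b \<and> \<not> l dvd b + c}"
  obtain c0 where c0: "c0 \<in> ?C"
  proof -
    have "\<exists>x\<in>B - {b}. \<exists>y\<in>B - {b}. x \<noteq> y"
    proof (rule ccontr)
      assume "\<not> ?thesis"
      then have "card (B - {b}) \<le> Suc 0" using assms(2) by (subst card_le_Suc0_iff_eq) auto
      then show False using assms(2,4) b by simp
    qed
    then obtain x y where xy: "x \<in> B" "y \<in> B" "x \<noteq> b" "y \<noteq> b" "x \<noteq> y" by blast
    have "\<not> (l dvd b + x \<and> l dvd b + y)"
      using dist[OF xy(1,2,5)] dvd_diff[of l "b + x" "b + y"] by auto
    then show thesis using that xy by blast
  qed
  \<comment> \<open>Otherwise \<open>e - b\<close> and \<open>e + b\<close> would be two entries for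
    \<open>b\<close>, against \<open>b2\<close>. Hence the same alternative of \<open>dich\<close>
    holds for every \<open>c\<close> in \<open>?C\<close>.\<close>
  have same: "e - b \<in> T \<or> e + 2 * b \<notin> T"
  proof (rule ccontr)
    assume "\<not> ?thesis"
    then have "l dvd (e + b) - (e - b)"
      using entry[OF b e(2), of "e - b"] e(1) by (simp add: algebra_simps)
    then show False using b2 by simp
  qed
  consider "e - b \<notin> T" | "e + 2 * b \<in> T" using dich[of b c0 e] c0 b e by blast
  then show ?thesis
  proof cases
    case 1
    have iso: "e + c \<notin> T" "e - c \<notin> T" if c: "c \<in> B" for c
    proof -
      have "e + c \<notin> T \<and> e - c \<notin> T"
      proof (cases "c \<in> ?C")
        case True
        then show ?thesis using dich[of b c e] b e 1 same by blast
      next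
        case False
        then have "c = b \<or> l dvd b + c" using c by blast
        then show ?thesis
        proof
          assume "l dvd b + c"
          moreover have "(e + c) - (e - b) = b + c" "(e - c) - (e + b) = - (b + c)" by simp_all
          ultimately have "l dvd (e + c) - (e - b)" "l dvd (e - c) - (e + b)"
            by (simp_all only: dvd_minus_iff)
          then show ?thesis using per 1 e(2) by blast
        qed (use 1 e in auto)
      qed
      then show "e + c \<notin> T" "e - c \<notin> T" by auto
    qed
    \<comment> \<open>This case is contradictory: \<open>?X\<close> is invariant, and nonempty
      because \<open>t1\<close> and \<open>t2\<close> are not both congruent to \<open>e\<close>, so
      it would have to contain \<open>e\<close>.\<close>
    let ?X = "{x \<in> T. \<not> l dvd x - e}"
    have closed: "x + c \<in> ?X" if c: "c \<in> B" and x: "x \<in> ?X" for x c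
    proof -
      have "x + c \<in> T" using exit[OF c, of x e] x e(1) iso(1)[OF c] by blast
      moreover have "\<not> l dvd (x + c) - e"
      proof
        assume "l dvd (x + c) - e"
        then have "l dvd x - (e - c)" by (simp add: algebra_simps)
        then show False using per iso(2)[OF c] x by blast
      qed
      ultimately show ?thesis by blast
    qed
    have perX: "y \<in> ?X" if "l dvd x - y" "x \<in> ?X" for x y
      using that per dvd_add[of l "x - y" "y - e"] by auto
    obtain t where "t \<in> ?X"
      using t dvd_diff[of l "t1 - e" "t2 - e"] by auto
    then have "e \<in> ?X"
      using translation_closed_UNIV[of l B ?X t e] assms(1-3) perX closed by blast
    then show ?thesis by simp
  next
    case 2
    define f where "f = e + b"
    have f: "f \<notin> T" using e f_def by simp
    have hole: "f + c \<in> T" "f - c \<in> T" if c: "c \<in> B" for c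
    proof -
      have "f + c \<in> T \<and> f - c \<in> T"
      proof (cases "c \<in> ?C")
        case True
        then show ?thesis using dich[of b c e] b e 2 same unfolding f_def by blast
      next
        case False
        then have "c = b \<or> l dvd b + c" using c by blast
        then show ?thesis
        proof
          assume "l dvd b + c"
          moreover have "e - (f + c) = - (b + c)" "(e + 2 * b) - (f - c) = b + c"
            by (simp_all add: f_def)
          ultimately have "l dvd e - (f + c)" "l dvd (e + 2 * b) - (f - c)"
            by (simp_all only: dvd_minus_iff)
          then show ?thesis using per 2 e(1) by blast
        qed (use 2 e in \<open>auto simp: f_def algebra_simps\<close>)
      qed
      then show "f + c \<in> T" "f - c \<in> T" by auto
    qed
    \<comment> \<open>If \<open>?Y\<close> were nonempty, invariance would put \<open>f\<close> into
      it. So \<open>?Y\<close> is empty, and only the class of \<open>f\<close> is missing from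
      \<open>T\<close>.\<close>
    let ?Y = "{y. y \<notin> T \<and> \<not> l dvd y - f}"
    have closed: "y + c \<in> ?Y" if c: "c \<in> B" and y: "y \<in> ?Y" for y c
    proof -
      have "y + c \<notin> T" using entry[OF c, of y f] y f hole(1)[OF c] by blast
      moreover have "\<not> l dvd (y + c) - f"
      proof
        assume "l dvd (y + c) - f"
        then have "l dvd (f - c) - y" by (simp add: dvd_diff_commute algebra_simps)
        then show False using per hole(2)[OF c] y by blast
      qed
      ultimately show ?thesis by blast
    qed
    have perY: "y \<in> ?Y" if "l dvd x - y" "x \<in> ?Y" for x y
      using that per[of y x] dvd_add[of l "x - y" "y - f"] by (auto simp: dvd_diff_commute)
    have "x \<notin> ?Y" for x
      using translation_closed_UNIV[of l B ?Y x f] assms(1-3) perY closed by auto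
    then show ?thesis by blast
  qed
qed

section \<open>Lower bounds for the number of residues\<close>

text \<open>0 and the elements of \<open>B\<close> already lie in distinct classes.\<close>

lemma card_residue_sums_gt:
  assumes "finite B" and nz: "\<And>b. b \<in> B \<Longrightarrow> \<not> l dvd b"
    and dist: "\<And>b c. b \<in> B \<Longrightarrow> c \<in> B \<Longrightarrow> b \<noteq> c \<Longrightarrow> \<not> l dvd b - c"
  shows "card B < card (residue_sums l B)"
proof -
  have "inj_on (\<lambda>s. s mod l) (insert 0 B)"
    using nz dist by (auto simp: inj_on_def mod_eq_dvd_iff dvd_diff_commute)
  moreover have "0 \<notin> B" using nz by force
  ultimately have "card ((\<lambda>s. s mod l) ` insert 0 B) = card B + 1"
    using assms(1) by (simp only: card_image) simp
  moreover have "(\<lambda>s. s mod l) ` insert 0 B \<subseteq> residue_sums l B"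
    unfolding residue_sums_def using assms(1) by (intro image_mono) (auto intro: elem_in_msums)
  ultimately show ?thesis
    using card_mono[OF finite_residue_sums, of "(\<lambda>s. s mod l) ` insert 0 B" l B] by linarith
qed

lemma mod_in_residue_sums_insert:
  assumes "finite B" "b \<notin> B"
  shows "x mod l \<in> residue_sums l (insert b B) \<longleftrightarrow>
    x mod l \<in> residue_sums l B \<or> (x - b) mod l \<in> residue_sums l B"
proof -
  have "x mod l \<in> (\<lambda>r. (r + b) mod l) ` residue_sums l B \<longleftrightarrow> (x - b) mod l \<in> residue_sums l B"
  proof
    assume "x mod l \<in> (\<lambda>r. (r + b) mod l) ` residue_sums l B"
    then obtain s where s: "s \<in> msums (mset_set B)" "x mod l = (s + b) mod l"
      by (auto simp: residue_sums_def mod_add_left_eq)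
    then have "(x - b) mod l = s mod l" by (simp add: mod_eq_dvd_iff algebra_simps)
    with s(1) show "(x - b) mod l \<in> residue_sums l B" by (simp add: residue_sums_def)
  next
    assume "(x - b) mod l \<in> residue_sums l B"
    moreover have "x mod l = ((x - b) mod l + b) mod l" by (simp add: mod_add_left_eq)
    ultimately show "x mod l \<in> (\<lambda>r. (r + b) mod l) ` residue_sums l B" by blast
  qed
  then show ?thesis by (simp add: residue_sums_insert[OF assms])
qed

text \<open>The slack 1 is what the last case of the induction needs, where one class modulo
  \<open>l\<close> may be missing.\<close>

lemma card_residue_sums_lower:
  assumes "0 < l" "finite B" "Gcd (insert l B) = 1"
    and nz: "\<And>b. b \<in> B \<Longrightarrow> \<not> l dvd b"
    and dist: "\<And>b c. b \<in> B \<Longrightarrow> c \<in> B \<Longrightarrow> b \<noteq> c \<Longrightarrow> \<not> l dvd b - c"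
  shows "min (nat l) (2 * card B) \<le> card (residue_sums l B) + 1"
  using assms(2-)
proof (induction "card B" arbitrary: B rule: less_induct)
  case less
  note fin = less.prems(1) and gcd1 = less.prems(2) and nz = less.prems(3) and dist = less.prems(4)
  have remove: "insert b (B - {b}) = B" "b \<notin> B - {b}" "finite (B - {b})" if "b \<in> B" for b
    using that fin by auto
  consider "card B \<le> 2"
    | b where "b \<in> B" "Gcd (insert l (B - {b})) \<noteq> 1"
    | b x y where "b \<in> B" "Gcd (insert l (B - {b})) = 1" "\<not> l dvd x - y"
        "x mod l \<in> residue_sums l (B - {b})" "(x + b) mod l \<notin> residue_sums l (B - {b})"
        "y mod l \<in> residue_sums l (B - {b})" "(y + b) mod l \<notin> residue_sums l (B - {b})"
    | "3 \<le> card B" "\<And>b x y. b \<in> B \<Longrightarrow>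
        x mod l \<in> residue_sums l (B - {b}) \<Longrightarrow> (x + b) mod l \<notin> residue_sums l (B - {b}) \<Longrightarrow>
        y mod l \<in> residue_sums l (B - {b}) \<Longrightarrow> (y + b) mod l \<notin> residue_sums l (B - {b}) \<Longrightarrow> l dvd x - y"
    by (metis not_less_eq_eq numeral_3_eq_3 numeral_2_eq_2)
  then show ?case
  proof cases
    \<comment> \<open>Here \<open>2 * card B\<close> is at most \<open>card B + 2\<close>.\<close>
    case 1
    then show ?thesis using card_residue_sums_gt[OF fin nz dist] by simp
  next
    \<comment> \<open>The gcd \<open>d\<close> divides every element of \<open>?R\<close> but not
      \<open>b\<close>, so \<open>?R\<close> and its translate by \<open>b\<close> are disjoint;
      doubling at least \<open>card B\<close> residues suffices.\<close>
    case (2 b)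
    note r = remove[OF 2(1)]
    let ?R = "residue_sums l (B - {b})"
    define d where "d = Gcd (insert l (B - {b}))"
    have d: "d dvd l" "\<And>c. c \<in> B - {b} \<Longrightarrow> d dvd c" unfolding d_def by (blast intro: Gcd_dvd)+
    have "\<not> d dvd b"
    proof
      assume "d dvd b"
      then have "d dvd c" if "c \<in> insert l B" for c using d that by blast
      then have "d dvd Gcd (insert l B)" by (rule Gcd_greatest)
      then have "d dvd 1" unfolding gcd1 .
      then have "d = 1" unfolding d_def by simp
      then show False using 2(2) d_def by simp
    qed
    have dR: "d dvd s" if "s \<in> ?R" for s
    proof -
      obtain t where "t \<in> msums (mset_set (B - {b}))" "s = t mod l" using \<open>s \<in> ?R\<close> by (auto simp: residue_sums_def)
      then show ?thesis using dvd_msums[of "mset_set (B - {b})" d t] d r(3) by (simp add: dvd_mod_iff)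
    qed
    let ?N = "(\<lambda>r. (r + b) mod l) ` ?R"
    have disj: "?R \<inter> ?N = {}"
    proof (rule ccontr)
      assume "?R \<inter> ?N \<noteq> {}"
      then obtain s where "s \<in> ?R" "d dvd (s + b) mod l" using dR by blast
      then show False using dR[of s] d(1) \<open>\<not> d dvd b\<close> by (simp add: dvd_mod_iff dvd_add_right_iff)
    qed
    have "inj_on (\<lambda>r. (r + b) mod l) ?R"
    proof (rule inj_onI)
      fix u v assume uv: "u \<in> ?R" "v \<in> ?R" "(u + b) mod l = (v + b) mod l"
      then have "u mod l = v mod l" by (simp add: mod_eq_dvd_iff)
      then show "u = v" using uv residue_sums_subset[OF \<open>0 < l\<close>, of "B - {b}"] by (auto simp: subset_iff)
    qed
    then have "card ?N = card ?R" by (rule card_image)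
    then have "card (residue_sums l B) = 2 * card ?R"
      using residue_sums_insert[OF r(3,2), of l] r(1) disj by (simp add: card_Un_disjoint)
    moreover have "card (B - {b}) < card ?R"
      using nz dist by (intro card_residue_sums_gt r(3)) auto
    ultimately show ?thesis using 2(1) fin by simp
  next
    \<comment> \<open>\<open>x + b\<close> and \<open>y + b\<close> represent two classes outside
      \<open>?R\<close>, exactly the increment by 2 that the induction requires.\<close>
    case (3 b x y)
    note r = remove[OF 3(1)]
    let ?R = "residue_sums l (B - {b})"
    have "card (B - {b}) < card B" using 3(1) fin by (meson card_Diff1_less)
    then have IH: "min (nat l) (2 * card (B - {b})) \<le> card ?R + 1"
      using less.hyps[of "B - {b}"] r(3) 3(2) nz dist by auto
    note mem = mod_in_residue_sums_insert[OF r(3,2), of _ l, unfolded r(1)]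
    have "?R \<subseteq> residue_sums l B"
      using residue_sums_insert[OF r(3,2), of l, unfolded r(1)] by blast
    moreover have "(x + b) mod l \<in> residue_sums l B" "(y + b) mod l \<in> residue_sums l B"
      using mem[of "x + b"] mem[of "y + b"] 3(4,6) by simp_all
    ultimately have "card (insert ((x + b) mod l) (insert ((y + b) mod l) ?R)) \<le> card (residue_sums l B)"
      by (intro card_mono) auto
    moreover have "(x + b) mod l \<noteq> (y + b) mod l" using 3(3) by (simp add: mod_eq_dvd_iff)
    ultimately have "card ?R + 2 \<le> card (residue_sums l B)" using 3(5,7) by simp
    with IH show ?thesis using card_Suc_Diff1[OF fin 3(1)] by linarith
  next
    case 4
    let ?T = "{x. x mod l \<in> residue_sums l B}"
    obtain b where b: "b \<in> B" using 4(1) by fastforce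
    have "\<exists>f. \<forall>x. x \<notin> ?T \<longrightarrow> l dvd x - f"
    proof (rule unique_exit_imp_at_most_one_class_missing[OF \<open>0 < l\<close> fin gcd1 4(1)])
      show "y \<in> ?T" if "l dvd x - y" "x \<in> ?T" for x y
        using that by (simp add: mod_eq_dvd_iff[symmetric])
      show "sum_mset (mset_set B) - x \<in> ?T" if "x \<in> ?T" for x
        using that mod_in_residue_sums_complement by simp
      show "l dvd x - y" if c: "c \<in> B" and xy: "x \<in> ?T" "x + c \<notin> ?T" "y \<in> ?T" "y + c \<notin> ?T" for c x y
      proof -
        note mem = mod_in_residue_sums_insert[OF remove(3,2)[OF c], of _ l, unfolded remove(1)[OF c]]
        \<comment> \<open>As \<open>z + c\<close> is not a sum of \<open>B\<close> modulo
          \<open>l\<close>, \<open>z\<close> is not one of \<open>B - {c}\<close>; it must therefore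
          arise from \<open>z - c\<close>. Thus exits of \<open>?T\<close> come from exits of the
          smaller residue set, shifted by \<open>c\<close>.\<close>
        have *: "(z - c) mod l \<in> residue_sums l (B - {c}) \<and> (z - c + c) mod l \<notin> residue_sums l (B - {c})"
          if "z \<in> ?T" "z + c \<notin> ?T" for z
          using that mem[of z] mem[of "z + c"] by auto
        have "l dvd (x - c) - (y - c)"
          using 4(2)[OF c] *[OF xy(1,2)] *[OF xy(3,4)] by blast
        then show ?thesis by simp
      qed
      have el: "s mod l \<in> residue_sums l B" if "s \<in> msums (mset_set B)" for s
        using that by (simp add: residue_sums_def)
      show "b \<in> ?T" using b fin by (auto intro!: el elem_in_msums)
      show "0 \<in> ?T" using el[of 0] by simp
      show "\<not> l dvd b - 0" using nz[OF b] by simp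
    qed (use nz dist in auto)
    then obtain f where f: "\<And>x. x mod l \<notin> residue_sums l B \<Longrightarrow> l dvd x - f" by blast
    have "{0..<l} - {f mod l} \<subseteq> residue_sums l B"
    proof
      fix x assume x: "x \<in> {0..<l} - {f mod l}"
      then have "x mod l \<noteq> f mod l" by simp
      then have "x mod l \<in> residue_sums l B" using f by (auto simp: mod_eq_dvd_iff)
      then show "x \<in> residue_sums l B" using x by simp
    qed
    then have "card ({0..<l} - {f mod l}) \<le> card (residue_sums l B)" by (intro card_mono) auto
    then show ?thesis using \<open>0 < l\<close> by simp
  qed
qed

section \<open>Complete residue systems by pigeonhole\<close>

text \<open>The summands must differ because \<open>B\<close> offers one copy of each; 0 stands for
  an absent summand.\<close>

lemma pair_in_msums:
  assumes "finite B" "u \<in> insert 0 B" "v \<in> insert 0 B" "u \<noteq> v"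
  shows "u + v \<in> msums (mset_set B)"
proof -
  have "u + v \<in> msums (mset_set B)" if "v \<in> B" "u \<in> insert 0 B" "u \<noteq> v" for u v
  proof -
    have "mset_set B = add_mset v (mset_set (B - {v}))"
      using that(1) assms(1) by (metis mset_set.remove)
    moreover have "u \<in> msums (mset_set (B - {v}))"
      using that assms(1) by (auto intro: elem_in_msums)
    ultimately show ?thesis by (simp add: msums_add)
  qed
  from this[of v u] this[of u v] show ?thesis using assms by (auto simp: add.commute)
qed

text \<open>Among \<open>l\<close> classes, \<open>?C\<close> and its reflection
  \<open>c - ?C\<close> have \<open>card B + 1\<close> elements each, so they share at least three.
  At most two classes are fixed by the reflection; any other common class gives \<open>c\<close> as
  a sum of two distinct elements of \<open>insert 0 B\<close>.\<close>

lemma residue_sums_full: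
  assumes "0 < l" "finite B" and nz: "\<And>b. b \<in> B \<Longrightarrow> \<not> l dvd b"
    and dist: "\<And>b c. b \<in> B \<Longrightarrow> c \<in> B \<Longrightarrow> b \<noteq> c \<Longrightarrow> \<not> l dvd b - c"
    and big: "nat l + 1 \<le> 2 * card B"
  shows "residue_sums l B = {0..<l}"
proof (intro equalityI subsetI)
  fix c assume c: "c \<in> {0..<l}"
  let ?C = "(\<lambda>s. s mod l) ` insert 0 B"
  let ?g = "\<lambda>x. (c - x) mod l"
  have CS: "?C \<subseteq> {0..<l}" using \<open>0 < l\<close> by auto
  have "inj_on (\<lambda>s. s mod l) (insert 0 B)"
    using nz dist by (auto simp: inj_on_def mod_eq_dvd_iff dvd_diff_commute)
  moreover have "0 \<notin> B" using nz by force
  ultimately have cardC: "card ?C = card B + 1"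
    using assms(2) by (simp only: card_image) simp
  have "inj_on ?g ?C"
  proof (rule inj_onI)
    fix x y assume xy: "x \<in> ?C" "y \<in> ?C" "?g x = ?g y"
    then have "x mod l = y mod l" by (simp add: mod_eq_dvd_iff dvd_diff_commute)
    then show "x = y" using xy(1,2) by auto
  qed
  then have "card (?g ` ?C) = card B + 1" using cardC card_image by metis
  moreover have "card (?C \<union> ?g ` ?C) \<le> card {0..<l}"
    using CS \<open>0 < l\<close> by (intro card_mono) auto
  moreover have "card (?C \<union> ?g ` ?C) + card (?C \<inter> ?g ` ?C) = card ?C + card (?g ` ?C)"
    using assms(2) by (intro card_Un_Int[symmetric]) auto
  ultimately have three: "3 \<le> card (?C \<inter> ?g ` ?C)" using cardC big by simp
  have "\<exists>x\<in>?C \<inter> ?g ` ?C. ?g x \<noteq> x"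
  proof (rule ccontr)
    assume "\<not> ?thesis"
    then have fixed: "?g x = x" if "x \<in> ?C \<inter> ?g ` ?C" for x using that by blast
    \<comment> \<open>Two fixed points both solve \<open>2 * x = c\<close> modulo \<open>l\<close>,
      so \<open>2 * (y - x)\<close> is a multiple of \<open>l\<close> strictly between 0 and
      \<open>2 * l\<close>.\<close>
    have half: "2 * (y - x) = l"
      if x: "x \<in> ?C \<inter> ?g ` ?C" and y: "y \<in> ?C \<inter> ?g ` ?C" and less: "x < y" for x y
    proof -
      have m: "x mod l = x" "y mod l = y" "0 \<le> x" "y < l" using x y \<open>0 < l\<close> by auto
      have "(c - x) mod l = x mod l" "(c - y) mod l = y mod l"
        using fixed[OF x] fixed[OF y] m by auto
      then have "l dvd (c - x - x) - (c - y - y)" unfolding mod_eq_dvd_iff by (rule dvd_diff)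
      then have "l dvd 2 * (y - x)" by (simp add: algebra_simps)
      then obtain q where q: "2 * (y - x) = l * q" by blast
      have "0 < l * q" "l * q < l * 2" unfolding q[symmetric] using less m(3,4) by simp_all
      then have "0 < q" "q < 2"
        using \<open>0 < l\<close> by (simp add: zero_less_mult_iff, metis mult_less_cancel_left_pos)
      then have "q = 1" by simp
      then show ?thesis using q by simp
    qed
    have no_three: False
      if x: "x \<in> ?C \<inter> ?g ` ?C" and y: "y \<in> ?C \<inter> ?g ` ?C" and z: "z \<in> ?C \<inter> ?g ` ?C"
        and lt: "x < y" "y < z" for x y z
      using half[OF x y lt(1)] half[OF x z less_trans[OF lt]] lt(2) by simp
    let ?I = "?C \<inter> ?g ` ?C"
    have fin: "finite ?I" using assms(2) by blast
    have ne: "?I \<noteq> {}" using three by (metis card.empty not_numeral_le_zero)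
    have "?I \<subseteq> {Min ?I, Max ?I}"
    proof
      fix x assume x: "x \<in> ?I"
      show "x \<in> {Min ?I, Max ?I}"
      proof (rule ccontr)
        assume "x \<notin> {Min ?I, Max ?I}"
        then have lt: "Min ?I < x" "x < Max ?I"
          using Min_le[OF fin x] Max_ge[OF fin x] by auto
        show False by (rule no_three[OF Min_in[OF fin ne] x Max_in[OF fin ne] lt])
      qed
    qed
    then have "card ?I \<le> card {Min ?I, Max ?I}" by (intro card_mono) auto
    also have "\<dots> \<le> 2" by (simp add: card_insert_if)
    finally show False using three by simp
  qed
  then obtain x where x: "x \<in> ?C" "x \<in> ?g ` ?C" "?g x \<noteq> x" by blast
  obtain u where u: "u \<in> insert 0 B" "x = u mod l" using x(1) by blast
  obtain v where v: "v \<in> insert 0 B" "x = (c - v mod l) mod l" using x(2) by blast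
  have "?g x = v mod l" unfolding v(2) by (simp add: mod_diff_right_eq)
  then have "u \<noteq> v" using x(3) u(2) by auto
  then have "u + v \<in> msums (mset_set B)" using pair_in_msums[OF assms(2) u(1) v(1)] by blast
  moreover have "(u + v) mod l = c"
  proof -
    have "(u + v) mod l = (x + v) mod l" by (simp add: u(2) mod_add_left_eq)
    also have "\<dots> = c mod l" unfolding v(2) by (simp add: mod_simps)
    finally show ?thesis using c by simp
  qed
  ultimately show "c \<in> residue_sums l B" unfolding residue_sums_def by blast
qed (use residue_sums_subset[OF \<open>0 < l\<close>] in blast)

section \<open>Multiplicities and the final estimates\<close>

lemma sum_mset_eq_sum_count:
  fixes f :: "'a \<Rightarrow> nat"
  assumes "finite A" "set_mset E \<subseteq> A"
  shows "(\<Sum>x\<in>#E. f x) = (\<Sum>x\<in>A. count E x * f x)"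
  using assms(2)
proof (induction E)
  case (add y E)
  have "(\<Sum>x\<in>A. count (add_mset y E) x * f x) = (\<Sum>x\<in>A. count E x * f x + (if x = y then f x else 0))"
    by (intro sum.cong) auto
  also have "\<dots> = (\<Sum>x\<in>A. count E x * f x) + f y"
    using assms(1) add.prems by (simp add: sum.distrib)
  finally show ?case using add by simp
qed simp

theorem theorem4p2:
  fixes k :: nat and a :: "nat \<Rightarrow> int" and r :: "nat \<Rightarrow> nat" and xs :: "int list"
  assumes "k \<ge> 1"
    and "seq_of k a r xs"
    and "\<And>i. i \<in> {1..k} \<Longrightarrow> a i > 0"
    and "strict_mono_on {1..k} a"
    and "\<And>i. i \<in> {1..k} \<Longrightarrow> r i \<ge> 1"
    and "Gcd (a ` {1..k}) = 1"
  shows "(a k \<le> 2 * int k - 3 \<longrightarrow>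
            real (card (subseq_sums xs)) \<ge>
              (\<Sum>i=1..k. real i * real (r i)) + real_of_int (a k) - real k) \<and>
         (a k \<ge> 2 * int k - 2 \<longrightarrow>
            real (card (subseq_sums xs)) \<ge>
              (\<Sum>i=1..k. real i * real (r i)) + golden * (real k + 1) - real k - 4)"
proof -
  define A where "A = a ` {1..k}"
  define l where "l = a k"
  define B where "B = a ` {1..<k}"
  \<comment> \<open>\<open>E\<close> holds the \<open>r i - 1\<close> surplus copies of each
    \<open>a i\<close>.\<close>
  define E where "E = mset xs - mset_set A"
  let ?\<rho> = "card (residue_sums l B)"
  have inj: "inj_on a {1..k}" and setxs: "set xs = A" and cnt: "\<And>i. i \<in> {1..k} \<Longrightarrow> count_list xs (a i) = r i"
    using assms(2) by (auto simp: seq_of_def A_def)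
  have mono: "a i < a j" if "i \<in> {1..k}" "j \<in> {1..k}" "i < j" for i j
    using assms(4) that by (auto simp: strict_mono_on_def)
  have pos: "0 < x" if "x \<in> A" for x using that assms(3) by (auto simp: A_def)
  have finA: "finite A" and finB: "finite B" by (simp_all add: A_def B_def)
  have "{1..k} = insert k {1..<k}" using assms(1) by auto
  then have AB: "A = insert l B" by (simp add: A_def B_def l_def)
  have Bl: "0 < b \<and> b < l" if "b \<in> B" for b
    using that pos AB mono assms(1) by (auto simp: B_def l_def)
  then have "l \<notin> B" by blast
  have "0 < l" using pos AB by blast
  have cardB: "card B = k - 1"
    unfolding B_def using inj by (subst card_image) (auto intro: inj_on_subset)
  have nz: "\<not> l dvd b" if "b \<in> B" for b using Bl[OF that] zdvd_not_zless by blast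
  have dist: "\<not> l dvd b - c" if "b \<in> B" "c \<in> B" "b \<noteq> c" for b c
    using Bl[OF that(1)] Bl[OF that(2)] that(3) dvd_imp_le_int[of "b - c" l] by auto
  have cardA: "1 + (\<Sum>i=1..k - 1. i) + ?\<rho> \<le> card (msums (mset_set A))"
  proof -
    have "1 + (\<Sum>i=1..k - 1. i) \<le> card (msums (mset_set B))"
      using card_msums_set[OF finB] Bl cardB by auto
    then show ?thesis
      using card_msums_add_residues[OF \<open>0 < l\<close>, of "mset_set B"] AB \<open>l \<notin> B\<close> finB
      by (simp add: residue_sums_def)
  qed
  have rank: "card {y \<in> A. y \<le> a i} = i" if i: "i \<in> {1..k}" for i
  proof -
    have "{y \<in> A. y \<le> a i} = a ` {1..i}"
    proof (intro equalityI subsetI)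
      fix y assume "y \<in> {y \<in> A. y \<le> a i}"
      then obtain j where j: "j \<in> {1..k}" "y = a j" "a j \<le> a i" by (auto simp: A_def)
      then have "j \<le> i" using mono[OF i j(1)] by force
      then show "y \<in> a ` {1..i}" using j by auto
    next
      fix y assume "y \<in> a ` {1..i}"
      then obtain j where j: "j \<in> {1..i}" "y = a j" by blast
      then have "a j \<le> a i" using mono[of j i] i by (cases "j = i") auto
      then show "y \<in> {y \<in> A. y \<le> a i}" using j i by (auto simp: A_def)
    qed
    then show ?thesis using inj i by (simp add: card_image inj_on_subset)
  qed
  have E: "mset_set A + E = mset xs"
  proof -
    have "mset_set A \<subseteq># mset xs"
      unfolding setxs[symmetric] by (rule mset_set_set_mset_msubset[of "mset xs", simplified])
    then show ?thesis by (simp add: E_def)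
  qed
  have setE: "set_mset E \<subseteq> A" using in_diffD setxs by (fastforce simp: E_def)
  have "(\<Sum>x\<in>#E. card {y \<in> A. y \<le> x}) = (\<Sum>x\<in>A. count E x * card {y \<in> A. y \<le> x})"
    by (rule sum_mset_eq_sum_count[OF finA setE])
  also have "\<dots> = (\<Sum>i=1..k. count E (a i) * card {y \<in> A. y \<le> a i})"
    unfolding A_def using inj by (subst sum.reindex) auto
  also have "\<dots> = (\<Sum>i=1..k. (r i - 1) * i)"
  proof (rule sum.cong)
    fix i assume i: "i \<in> {1..k}"
    have "count E (a i) = r i - 1"
      using cnt[OF i] finA i by (simp add: E_def count_mset A_def)
    then show "count E (a i) * card {y \<in> A. y \<le> a i} = (r i - 1) * i" using rank[OF i] by simp
  qed simp
  finally have sumE: "(\<Sum>x\<in>#E. card {y \<in> A. y \<le> x}) = (\<Sum>i=1..k. (r i - 1) * i)" .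
  have "Suc (card (subseq_sums xs)) = card (msums (mset xs))"
    using card_subseq_sums setxs pos by blast
  \<comment> \<open>The \<open>Suc\<close> for the empty sum cancels the 1 in
    \<open>cardA\<close>.\<close>
  then have total: "(\<Sum>i=1..k - 1. i) + ?\<rho> + (\<Sum>i=1..k. (r i - 1) * i) \<le> card (subseq_sums xs)"
    using card_msums_extra[OF finA pos setE] sumE cardA E by simp
  have split: "(\<Sum>i=1..k. i * r i) = (\<Sum>i=1..k - 1. i) + k + (\<Sum>i=1..k. (r i - 1) * i)"
  proof -
    have "(\<Sum>i=1..k. i * r i) = (\<Sum>i=1..k. i + (r i - 1) * i)"
    proof (rule sum.cong)
      fix i assume "i \<in> {1..k}"
      then obtain q where "r i = Suc q" using assms(5)[of i] by (cases "r i") auto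
      then show "i * r i = i + (r i - 1) * i" by simp
    qed simp
    moreover have "(\<Sum>i=1..k. i) = (\<Sum>i=1..k - 1. i) + k" using assms(1) by (cases k) auto
    ultimately show ?thesis by (simp add: sum.distrib)
  qed
  have "(\<Sum>i=1..k. i * r i) + ?\<rho> \<le> card (subseq_sums xs) + k" using total split by linarith
  then have "real ((\<Sum>i=1..k. i * r i) + ?\<rho>) \<le> real (card (subseq_sums xs) + k)" by (rule of_nat_mono)
  then have main: "(\<Sum>i=1..k. real i * real (r i)) + real ?\<rho> - real k \<le> real (card (subseq_sums xs))"
    by simp
  show ?thesis
  proof (intro conjI impI)
    assume "a k \<le> 2 * int k - 3"
    \<comment> \<open>Since \<open>2 * card B = 2 * k - 2\<close>, the hypothesis is exactly the
      pigeonhole threshold.\<close>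
    then have "nat l + 1 \<le> 2 * card B" using cardB \<open>0 < l\<close> by (simp add: l_def)
    then have "?\<rho> = nat l" using residue_sums_full[OF \<open>0 < l\<close> finB nz dist] by simp
    then show "(\<Sum>i=1..k. real i * real (r i)) + real_of_int (a k) - real k \<le> real (card (subseq_sums xs))"
      using main \<open>0 < l\<close> by (simp add: l_def)
  next
    assume ge: "a k \<ge> 2 * int k - 2"
    have "min (nat l) (2 * card B) \<le> ?\<rho> + 1"
      using assms(6) AB by (intro card_residue_sums_lower \<open>0 < l\<close> finB nz dist) (auto simp: A_def)
    \<comment> \<open>Now \<open>l\<close> is at least \<open>2 * card B\<close>, so the minimum is
      \<open>2 * k - 2\<close>.\<close>
    then have rho: "2 * k \<le> ?\<rho> + 3" using ge cardB by (simp add: l_def min_def split: if_splits)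
    have "sqrt 5 \<le> 2.24" by (rule real_le_lsqrt) (simp_all add: power2_eq_square)
    then have gold: "golden \<le> 1.62" by (simp add: golden_def)
    have "golden * (real k + 1) \<le> 1.62 * (real k + 1)" using gold by (intro mult_right_mono) auto
    \<comment> \<open>For \<open>k = 1\<close> the left side is 3.24, below 4 whatever
      \<open>?\<rho>\<close> is; from \<open>k = 2\<close> on it is at most
      \<open>2 * k + 1\<close>.\<close>
    also have "\<dots> \<le> real ?\<rho> + 4"
    proof (cases "k = 1")
      case False
      then have "2 \<le> real k" using assms(1) by simp
      moreover have "2 * real k \<le> real ?\<rho> + 3" using rho by linarith
      ultimately show ?thesis by simp
    qed simp
    finally show "(\<Sum>i=1..k. real i * real (r i)) + golden * (real k + 1) - real k - 4
        \<le> real (card (subseq_sums xs))"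
      using main by linarith
  qed
qed

end
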